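(* For every positive integer $d$, the collection of all finite nonempty subsets of $[0,1]^d$ is $\sigma$-strongly porous in $K[0,1]^d$.
   Context: Let $[0,1]^d$ carry the Euclidean metric, denoted $\varrho$. $K[0,1]^d$ denotes the space of all nonempty compact subsets of $[0,1]^d$, equipped with the Hausdorff metric $d_H(A,B)=\min\{r\ge 0: A\subseteq \widetilde{B}_r \text{ and } B\subseteq\widetilde{A}_r\}$, where $\widetilde{C}_r=\bigcup_{c\in C}\{x\in[0,1]^d: \varrho(x,c)\le r\}$. Let $(X,\rho)$ be a metric space and write $B(z,r)$ for the open ball of radius $r$ centered at $z$. A set $A\subseteq X$ is strongly porous (in $X$) if for each $x\in X$ there are sequences $(x_n)\subseteq X$ and $(r_n)\subseteq(0,+\infty)$ such that $\lim_n x_n=x$, $\rho(x,x_n)>0$ for all $n$, $\lim_n \frac{r_n}{\rho(x,x_n)}=1$, and $B(x_n,r_n)\cap A=\emptyset$ for all $n$. A set is $\sigma$-strongly porous (in $X$) if it is a countable union of strongly porous sets. Here $X=K[0,1]^d$ and $\rho=d_H$. *)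

theory Defs
  imports "HOL-Analysis.Analysis"
begin

context Metric_space
begin

definition strongly_porous :: "'a set \<Rightarrow> bool"
  where "strongly_porous A \<longleftrightarrow>
    A \<subseteq> M \<and>
    (\<forall>x\<in>M. \<exists>(xs :: nat \<Rightarrow> 'a) (rs :: nat \<Rightarrow> real).
       (\<forall>n. xs n \<in> M) \<and> (\<forall>n. rs n > 0) \<and>
       limitin mtopology xs x sequentially \<and>
       (\<forall>n. d x (xs n) > 0) \<and>
       (\<lambda>n. rs n / d x (xs n)) \<longlonglongrightarrow> 1 \<and>
       (\<forall>n. mball (xs n) (rs n) \<inter> A = {}))"

definition sigma_strongly_porous :: "'a set \<Rightarrow> bool"
  where "sigma_strongly_porous S \<longleftrightarrow>
    (\<exists>\<A>. countable \<A> \<and> (\<forall>A\<in>\<A>. strongly_porous A) \<and> S = \<Union>\<A>)"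

end

definition hyperspace :: "'a::metric_space set \<Rightarrow> 'a set set"
  where "hyperspace X = {A. A \<noteq> {} \<and> compact A \<and> A \<subseteq> X}"

definition enlargement :: "'a::metric_space set \<Rightarrow> 'a set \<Rightarrow> real \<Rightarrow> 'a set"
  where "enlargement X C r = (\<Union>c\<in>C. {x \<in> X. dist x c \<le> r})"

text \<open>The minimum exists for members of the hyperspace (see \<open>hausdist_min\<close> below). The value
  \<open>0\<close> elsewhere is a dummy: the locale \<^locale>\<open>Metric_space\<close> wants the distance to be
  nonnegative and symmetric also outside the carrier.\<close>

definition hausdist :: "'a::metric_space set \<Rightarrow> 'a set \<Rightarrow> 'a set \<Rightarrow> real"
  where "hausdist X A B =
    (if A \<in> hyperspace X \<and> B \<in> hyperspace X
     then LEAST r. r \<ge> 0 \<and> A \<subseteq> enlargement X B r \<and> B \<subseteq> enlargement X A r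
     else 0)"

definition unit_cube :: "(real ^ 'n) set"
  where "unit_cube = {x. \<forall>i. 0 \<le> x $ i \<and> x $ i \<le> 1}"

lemma subset_enlargement_iff:
  assumes "A \<subseteq> X" "B \<in> hyperspace X"
  shows "A \<subseteq> enlargement X B r \<longleftrightarrow> (\<forall>a\<in>A. infdist a B \<le> r)"
proof -
  have B: "B \<noteq> {}" "compact B"
    using assms(2) by (auto simp: hyperspace_def)
  have "(\<exists>b\<in>B. dist a b \<le> r) \<longleftrightarrow> infdist a B \<le> r" for a
  proof
    assume "\<exists>b\<in>B. dist a b \<le> r"
    then show "infdist a B \<le> r" using infdist_le2 by blast
  next
    assume le: "infdist a B \<le> r"
    obtain b where b: "b \<in> B" "\<And>y. y \<in> B \<Longrightarrow> dist a b \<le> dist a y"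
      using continuous_attains_inf [OF B(2,1), of "dist a"]
        continuous_on_dist [OF continuous_on_const continuous_on_id, of B a] by auto
    have "dist a b \<le> infdist a B"
      unfolding infdist_notempty [OF B(1)] using B(1) b(2) by (rule cINF_greatest)
    with le b(1) show "\<exists>b\<in>B. dist a b \<le> r"
      using order_trans by blast
  qed
  moreover have "A \<subseteq> enlargement X B r \<longleftrightarrow> (\<forall>a\<in>A. \<exists>b\<in>B. dist a b \<le> r)"
    using assms(1) by (auto simp: enlargement_def)
  ultimately show ?thesis by simp
qed

lemma hausdist_min:
  assumes A: "A \<in> hyperspace X" and B: "B \<in> hyperspace X"
  shows "hausdist X A B \<ge> 0" (is ?nonneg)
    and "A \<subseteq> enlargement X B (hausdist X A B)" (is ?AB)
    and "B \<subseteq> enlargement X A (hausdist X A B)" (is ?BA)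
    and "\<And>r. r \<ge> 0 \<Longrightarrow> A \<subseteq> enlargement X B r \<Longrightarrow> B \<subseteq> enlargement X A r \<Longrightarrow> hausdist X A B \<le> r"
proof -
  define P where "P r \<longleftrightarrow> r \<ge> 0 \<and> A \<subseteq> enlargement X B r \<and> B \<subseteq> enlargement X A r" for r
  define S where "S = Collect P"
  have sub: "A \<subseteq> X" "B \<subseteq> X" and ne: "A \<noteq> {}" "B \<noteq> {}" and cpt: "compact A" "compact B"
    using A B by (auto simp: hyperspace_def)
  have "S = {0..} \<inter> (\<Inter>a\<in>A. {infdist a B..}) \<inter> (\<Inter>b\<in>B. {infdist b A..})"
    unfolding S_def P_def subset_enlargement_iff [OF sub(1) B] subset_enlargement_iff [OF sub(2) A]
    by blast
  then have cl: "closed S" by (auto intro!: closed_Int closed_INT)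
  have bdd: "bdd_below S"
    by (rule bdd_belowI [of _ 0]) (auto simp: S_def P_def)
  have "bounded (A \<union> B)"
    using cpt by (simp add: compact_imp_bounded)
  then obtain e where e: "\<forall>x\<in>A \<union> B. \<forall>y\<in>A \<union> B. dist x y \<le> e"
    unfolding bounded_two_points by blast
  have "A \<subseteq> enlargement X B \<bar>e\<bar>" "B \<subseteq> enlargement X A \<bar>e\<bar>"
    using e sub ne abs_ge_self [of e] unfolding enlargement_def by (blast intro: order_trans)+
  then have "\<bar>e\<bar> \<in> S"
    by (simp add: S_def P_def)
  then have "S \<noteq> {}" by blast
  then have "Inf S \<in> S"
    using closed_contains_Inf bdd cl by blast
  then have PI: "P (Inf S)" by (simp add: S_def)
  have "Inf S \<le> r" if "P r" for r
    using that bdd by (simp add: S_def cInf_lower)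
  then have eq: "hausdist X A B = Inf S"
    unfolding hausdist_def P_def [symmetric] using A B PI by (simp add: Least_equality)
  show ?nonneg ?AB ?BA
    using PI unfolding eq P_def by auto
  show "hausdist X A B \<le> r" if "r \<ge> 0" "A \<subseteq> enlargement X B r" "B \<subseteq> enlargement X A r" for r
    using that bdd unfolding eq by (intro cInf_lower) (auto simp: S_def P_def)
qed

lemma enlargement_trans:
  assumes "A \<subseteq> enlargement X B r" "B \<subseteq> enlargement X C s"
  shows "A \<subseteq> enlargement X C (r + s)"
proof
  fix a assume "a \<in> A"
  then obtain b where b: "b \<in> B" "a \<in> X" "dist a b \<le> r"
    using assms(1) by (auto simp: enlargement_def)
  then obtain c where c: "c \<in> C" "dist b c \<le> s"
    using assms(2) by (auto simp: enlargement_def)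
  have "dist a c \<le> r + s"
    using dist_triangle [of a c b] b c by linarith
  then show "a \<in> enlargement X C (r + s)"
    using b c by (auto simp: enlargement_def)
qed

lemma enlargement_0: "enlargement X C 0 = C \<inter> X"
  by (auto simp: enlargement_def)

lemma Metric_space_hyperspace: "Metric_space (hyperspace X) (hausdist X)"
proof
  fix A B :: "'a set"
  show "0 \<le> hausdist X A B"
    using hausdist_min(1) [of A X B] by (cases "A \<in> hyperspace X \<and> B \<in> hyperspace X")
      (auto simp: hausdist_def)
  show "hausdist X A B = hausdist X B A"
    by (simp add: hausdist_def conj_commute)
next
  fix A B :: "'a set"
  assume AB: "A \<in> hyperspace X" "B \<in> hyperspace X"
  then have sub: "A \<subseteq> X" "B \<subseteq> X" by (auto simp: hyperspace_def)
  show "hausdist X A B = 0 \<longleftrightarrow> A = B"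
  proof
    assume "hausdist X A B = 0"
    then show "A = B"
      using hausdist_min(2,3) [OF AB] by (auto simp: enlargement_0)
  next
    assume "A = B"
    then show "hausdist X A B = 0"
      using hausdist_min(1,4) [OF AB] sub by (force simp: enlargement_0)
  qed
next
  fix A B C :: "'a set"
  assume ABC: "A \<in> hyperspace X" "B \<in> hyperspace X" "C \<in> hyperspace X"
  note AB = hausdist_min [OF ABC(1,2)] and BC = hausdist_min [OF ABC(2,3)]
  show "hausdist X A C \<le> hausdist X A B + hausdist X B C"
  proof (rule hausdist_min(4) [OF ABC(1,3)])
    show "A \<subseteq> enlargement X C (hausdist X A B + hausdist X B C)"
      using enlargement_trans AB(2) BC(2) by blast
    show "C \<subseteq> enlargement X A (hausdist X A B + hausdist X B C)"
      using enlargement_trans [OF BC(3) AB(3)] by (simp add: add.commute)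
  qed (use AB(1) BC(1) in simp)
qed

end

theory Submission
  imports Defs
begin

text \<open>
  Fix a coordinate \<open>i\<close>. A finite set either has all its points on the two faces \<open>x\<^sub>i \<in> {0, 1}\<close>,
  or, for some \<open>\<delta> > 0\<close>, it is \<open>\<delta>\<close>-separated and has a point with \<open>\<delta> \<le> x\<^sub>i \<le> 1 - \<delta>\<close>. Both
  conditions define closed families of compact sets, so only porosity at the members \<open>K\<close> of the
  family matters. In the first case, move a point of \<open>K\<close> by \<open>t\<close> into the interior along the
  \<open>i\<close>-th axis and add the result to \<open>K\<close>: no set within distance less than \<open>t\<close> of the result lies on the faces. In the second
  case, add the two points \<open>p \<plusminus> t e\<^sub>i\<close>, where \<open>p\<close> is the point with \<open>\<delta> \<le> p\<^sub>i \<le> 1 - \<delta>\<close>: a set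
  within distance less than \<open>t\<close> of the result has two distinct points at distance less than
  \<open>4 t\<close>, so it is not \<open>\<delta>\<close>-separated once \<open>4 t \<le> \<delta>\<close>.
\<close>

section \<open>Criteria for strong porosity in a metric space\<close>

context Metric_space
begin

lemma strongly_porous_subset:
  "strongly_porous B \<Longrightarrow> A \<subseteq> B \<Longrightarrow> strongly_porous A"
  unfolding strongly_porous_def by (meson disjoint_iff subset_iff)

text \<open>Choosing the radius \<open>rs n\<close> equal to \<open>d x (xs n)\<close> makes the
  ratio in the definition constantly 1. So it is enough to find, arbitrarily near \<open>x\<close>,
  centres whose open ball reaching exactly up to \<open>x\<close> misses \<open>A\<close>.\<close>

lemma strongly_porousI:
  assumes "A \<subseteq> M"
    and ex: "\<And>x e. x \<in> M \<Longrightarrow> e > 0 \<Longrightarrow> \<exists>y\<in>M. 0 < d x y \<and> d x y < e \<and> mball y (d x y) \<inter> A = {}"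
  shows "strongly_porous A"
  unfolding strongly_porous_def
proof (intro conjI ballI)
  fix x assume x: "x \<in> M"
  have "\<forall>n. \<exists>y\<in>M. 0 < d x y \<and> d x y < inverse (real (Suc n)) \<and> mball y (d x y) \<inter> A = {}"
    using ex [OF x] by simp
  then obtain ys where ys: "\<And>n. ys n \<in> M" "\<And>n. 0 < d x (ys n)"
      "\<And>n. d x (ys n) < inverse (real (Suc n))" "\<And>n. mball (ys n) (d x (ys n)) \<inter> A = {}"
    by metis
  have "(\<lambda>n. d x (ys n)) \<longlonglongrightarrow> 0"
    by (rule tendsto_sandwich [OF _ _ tendsto_const LIMSEQ_inverse_real_of_nat])
      (use ys(3) in \<open>auto intro!: always_eventually less_imp_le simp del: of_nat_Suc\<close>)
  then have "limitin mtopology ys x sequentially"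
    using x ys(1) by (simp add: limitin_metric_dist_null commute)
  moreover have "(\<lambda>n. d x (ys n) / d x (ys n)) \<longlonglongrightarrow> 1"
    using ys(2) by (simp add: less_imp_neq [THEN not_sym])
  ultimately show "\<exists>xs rs. (\<forall>n. xs n \<in> M) \<and> (\<forall>n. rs n > 0) \<and>
       limitin mtopology xs x sequentially \<and> (\<forall>n. d x (xs n) > 0) \<and>
       (\<lambda>n. rs n / d x (xs n)) \<longlonglongrightarrow> 1 \<and> (\<forall>n. mball (xs n) (rs n) \<inter> A = {})"
    using ys by (intro exI [of _ ys] exI [of _ "\<lambda>n. d x (ys n)"]) auto
qed (fact assms(1))

text \<open>Away from the closed set \<open>C\<close> every sufficiently near point serves as a
  centre, which is what \<open>perfect\<close> supplies. At a point of \<open>C\<close> the upper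
  bound \<open>d x y \<le> t\<close> is enough: \<open>x\<close> lies in \<open>C\<close> and hence
  outside \<open>mball y t\<close>, which forces \<open>d x y = t\<close>.\<close>

lemma strongly_porous_closedin:
  assumes cl: "closedin mtopology C"
    and perfect: "\<And>x e. x \<in> M \<Longrightarrow> e > 0 \<Longrightarrow> \<exists>y\<in>M. 0 < d x y \<and> d x y < e"
    and ex: "\<And>x e. x \<in> C \<Longrightarrow> e > 0 \<Longrightarrow> \<exists>y\<in>M. \<exists>t. 0 < t \<and> t < e \<and> d x y \<le> t \<and> mball y t \<inter> C = {}"
  shows "strongly_porous C"
proof (rule strongly_porousI)
  show sub: "C \<subseteq> M"
    using cl by (simp add: closedin_metric)
  fix x and e :: real
  assume x: "x \<in> M" and e: "e > 0"
  show "\<exists>y\<in>M. 0 < d x y \<and> d x y < e \<and> mball y (d x y) \<inter> C = {}"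
  proof (cases "x \<in> C")
    case True
    then obtain y t where y: "y \<in> M" "0 < t" "t < e" "d x y \<le> t" "mball y t \<inter> C = {}"
      using ex e by blast
    then have "\<not> d y x < t"
      using True x by (auto simp: in_mball disjoint_iff)
    then have "d x y = t"
      using y commute by force
    with y show ?thesis by auto
  next
    case False
    then obtain r where r: "r > 0" "disjnt C (mball x r)"
      using cl x by (force simp: closedin_metric)
    \<comment> \<open>With \<open>d x y < r / 2\<close>, the ball of radius \<open>d x y\<close>
      about \<open>y\<close> stays within distance \<open>r\<close> of \<open>x\<close>.\<close>
    obtain y where y: "y \<in> M" "0 < d x y" "d x y < min e (r / 2)"
      using perfect [OF x, of "min e (r / 2)"] e r by auto
    have "mball y (d x y) \<subseteq> mball x r"
      using x y by (intro mball_subset) (auto simp: commute)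
    with r have "mball y (d x y) \<inter> C = {}"
      by (auto simp: disjnt_def)
    with y show ?thesis
      by auto
  qed
qed

end

section \<open>Estimates for the Hausdorff distance and shifts along an axis\<close>

lemma hausdist_le:
  assumes "A \<in> hyperspace X" "B \<in> hyperspace X" "r \<ge> 0"
    and "\<And>a. a \<in> A \<Longrightarrow> \<exists>b\<in>B. dist a b \<le> r" "\<And>b. b \<in> B \<Longrightarrow> \<exists>a\<in>A. dist b a \<le> r"
  shows "hausdist X A B \<le> r"
  using assms by (intro hausdist_min(4)) (auto simp: enlargement_def hyperspace_def)

lemma hausdist_obtain:
  assumes "A \<in> hyperspace X" "B \<in> hyperspace X" "hausdist X A B < r" "a \<in> A"
  obtains b where "b \<in> B" "dist a b < r"
proof -
  have "a \<in> enlargement X B (hausdist X A B)"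
    using hausdist_min(2) [OF assms(1,2)] assms(4) by blast
  then show ?thesis
    using assms(3) that by (force simp: enlargement_def)
qed

lemma norm_axis: "norm (axis i t :: real ^ 'n) = \<bar>t\<bar>"
  by (simp add: norm_eq_sqrt_inner inner_axis_axis)

lemma dist_add_axis:
  fixes p :: "real ^ 'n"
  shows "dist (p + axis i s) (p + axis i t) = \<bar>s - t\<bar>"
proof -
  have "axis i s - axis i t = (axis i (s - t) :: real ^ 'n)"
    by (simp add: vec_eq_iff axis_def)
  then show ?thesis by (simp add: dist_norm norm_axis)
qed

lemma dist_self_add_axis:
  fixes p :: "real ^ 'n"
  shows "dist p (p + axis i t) = \<bar>t\<bar>"
  by (simp add: dist_norm norm_axis)

lemma add_axis_in_unit_cube:
  assumes "p \<in> unit_cube" "0 \<le> p $ i + t" "p $ i + t \<le> 1"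
  shows "p + axis i t \<in> unit_cube"
  using assms by (auto simp: unit_cube_def axis_def)

text \<open>The sign of \<open>t\<close> is chosen to move away from the nearer of the two faces,
  which leaves room for a shift of length 1/2.\<close>

lemma unit_cube_obtain_shift:
  fixes p :: "real ^ 'n"
  assumes "p \<in> unit_cube" "0 < s" "s \<le> 1 / 2"
  obtains t where "\<bar>t\<bar> = s" "p + axis i t \<in> unit_cube"
proof -
  have "0 \<le> p $ i" "p $ i \<le> 1"
    using assms by (auto simp: unit_cube_def)
  then show ?thesis
    using assms that [of s] that [of "- s"] add_axis_in_unit_cube [of p i]
    by (cases "p $ i \<le> 1 / 2") auto
qed

lemma insert_in_hyperspace:
  "K \<in> hyperspace X \<Longrightarrow> x \<in> X \<Longrightarrow> insert x K \<in> hyperspace X"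
  by (auto simp: hyperspace_def)

section \<open>The hyperspace of the cube has no isolated points\<close>

interpretation cube: Metric_space "hyperspace (unit_cube :: (real ^ 'n) set)" "hausdist unit_cube"
  by (rule Metric_space_hyperspace)

text \<open>Adding a point might not change \<open>K\<close>, and removing a ball might leave
  nothing. So the part of \<open>K\<close> in \<open>ball p s\<close> is replaced by one point
  \<open>q\<close> at distance \<open>s\<close> from \<open>p\<close>: the point \<open>p\<close> is
  lost, and every removed point is within \<open>2 * s\<close> of \<open>q\<close>.\<close>

lemma hyperspace_unit_cube_perfect:
  fixes K :: "(real ^ 'n) set"
  assumes K: "K \<in> hyperspace unit_cube" and e: "e > 0"
  shows "\<exists>L\<in>hyperspace unit_cube. 0 < hausdist unit_cube K L \<and> hausdist unit_cube K L < e"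
proof -
  obtain p where p: "p \<in> K" "p \<in> unit_cube"
    using K by (auto simp: hyperspace_def)
  define s where "s = min (e / 3) (1 / 2)"
  have s: "0 < s" "s \<le> 1 / 2" "2 * s < e"
    using e by (auto simp: s_def min_def)
  \<comment> \<open>The direction is irrelevant; \<open>undefined\<close> merely names some
    coordinate.\<close>
  obtain t where t: "\<bar>t\<bar> = s" "p + axis undefined t \<in> unit_cube"
    using unit_cube_obtain_shift [OF p(2) s(1,2)] by blast
  define q where "q = p + axis undefined t"
  have pq: "dist p q = s"
    unfolding q_def dist_self_add_axis by (fact t(1))
  define L where "L = insert q (K - ball p s)"
  have L: "L \<in> hyperspace unit_cube"
    using K t(2) unfolding L_def q_def hyperspace_def
    by (auto intro!: compact_insert compact_diff)
  have "p \<notin> L"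
    using pq s by (auto simp: L_def)
  then have "K \<noteq> L"
    using p by auto
  then have "0 < hausdist unit_cube K L"
    using K L cube.mdist_pos_less by blast
  moreover have "hausdist unit_cube K L \<le> 2 * s"
  proof (rule hausdist_le [OF K L])
    show "\<exists>b\<in>L. dist a b \<le> 2 * s" if "a \<in> K" for a
    proof (cases "a \<in> ball p s")
      case True
      then have "dist a q \<le> 2 * s"
        using pq dist_triangle [of a q p] by (simp add: dist_commute)
      then show ?thesis by (auto simp: L_def)
    next
      case False
      then show ?thesis
        using that s by (intro bexI [of _ a]) (auto simp: L_def)
    qed
    show "\<exists>a\<in>K. dist b a \<le> 2 * s" if "b \<in> L" for b
    proof (cases "b = q")
      case True
      then show ?thesis
        using pq s p by (intro bexI [of _ p]) (auto simp: dist_commute)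
    next
      case False
      then show ?thesis
        using that s by (intro bexI [of _ b]) (auto simp: L_def)
    qed
  qed (use s in simp)
  ultimately show ?thesis
    using L s by force
qed

section \<open>Two closed families of compact sets\<close>

definition face_sets :: "'n \<Rightarrow> (real ^ 'n) set set"
  where "face_sets i = {K \<in> hyperspace unit_cube. \<forall>x\<in>K. x $ i = 0 \<or> x $ i = 1}"

text \<open>One parameter bounds both the separation and the distance of \<open>p\<close> from the
  two faces, so a single sequence of values tending to 0 will cover all cases.\<close>

definition separated_sets :: "'n \<Rightarrow> real \<Rightarrow> (real ^ 'n) set set"
  where "separated_sets i \<delta> = {K \<in> hyperspace unit_cube.
    (\<forall>x\<in>K. \<forall>y\<in>K. x \<noteq> y \<longrightarrow> \<delta> \<le> dist x y) \<and> (\<exists>p\<in>K. \<delta> \<le> p $ i \<and> p $ i \<le> 1 - \<delta>)}"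

lemma abs_nth_diff_le_dist: "\<bar>x $ i - y $ i\<bar> \<le> dist x (y :: real ^ 'n)"
  using dist_vec_nth_le [of x i y] by (simp add: dist_real_def)

lemma closedin_face_sets:
  fixes i :: "'n::finite"
  shows "closedin cube.mtopology (face_sets i)"
  unfolding cube.closedin_metric
proof (intro conjI allI impI)
  show "face_sets i \<subseteq> hyperspace unit_cube"
    by (auto simp: face_sets_def)
  fix K assume KD: "K \<in> hyperspace unit_cube - face_sets i"
  then have K: "K \<in> hyperspace unit_cube" by simp
  obtain p where p: "p \<in> K" "p $ i \<noteq> 0" "p $ i \<noteq> 1"
    using KD by (auto simp: face_sets_def)
  \<comment> \<open>This is the distance from \<open>p $ i\<close> to {0, 1}; moving
    \<open>p\<close> by less than \<open>r\<close> cannot bring its coordinate to either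
    value.\<close>
  define r where "r = min \<bar>p $ i\<bar> \<bar>p $ i - 1\<bar>"
  have "F \<notin> face_sets i" if F: "F \<in> cube.mball K r" for F
  proof -
    obtain q where q: "q \<in> F" "dist p q < r"
      using hausdist_obtain [OF K, of F r p] F p by auto
    then have "q $ i \<noteq> 0" "q $ i \<noteq> 1"
      using abs_nth_diff_le_dist [of p i q] by (auto simp: r_def)
    then show ?thesis
      using q by (auto simp: face_sets_def)
  qed
  moreover have "r > 0"
    using p by (simp add: r_def)
  ultimately show "\<exists>r>0. disjnt (face_sets i) (cube.mball K r)"
    by (auto simp: disjnt_iff)
qed

lemma closedin_separated_sets:
  fixes i :: "'n::finite"
  shows "closedin cube.mtopology (separated_sets i \<delta>)"
  unfolding cube.closedin_metric
proof (intro conjI allI impI)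
  show "separated_sets i \<delta> \<subseteq> hyperspace unit_cube"
    by (auto simp: separated_sets_def)
  fix K assume KD: "K \<in> hyperspace unit_cube - separated_sets i \<delta>"
  then have K: "K \<in> hyperspace unit_cube" by simp
  consider (close) x y where "x \<in> K" "y \<in> K" "x \<noteq> y" "dist x y < \<delta>"
    | (far) "\<forall>p\<in>K. \<not> (\<delta> \<le> p $ i \<and> p $ i \<le> 1 - \<delta>)"
    using KD by (auto simp: separated_sets_def not_le)
  then show "\<exists>r>0. disjnt (separated_sets i \<delta>) (cube.mball K r)"
  proof cases
    case close
    \<comment> \<open>Moving \<open>x\<close> and \<open>y\<close> by less than \<open>r\<close>
      each changes their distance by less than \<open>2 * r\<close>, so it stays strictly between 0
      and \<open>\<delta>\<close>.\<close>
    define r where "r = min (dist x y) (\<delta> - dist x y) / 2"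
    have "F \<notin> separated_sets i \<delta>" if F: "F \<in> cube.mball K r" for F
    proof -
      obtain a where a: "a \<in> F" "dist x a < r"
        using hausdist_obtain [OF K, of F r x] F close by auto
      obtain b where b: "b \<in> F" "dist y b < r"
        using hausdist_obtain [OF K, of F r y] F close by auto
      have r: "2 * r \<le> dist x y" "2 * r \<le> \<delta> - dist x y"
        by (auto simp: r_def)
      have "dist x y \<le> dist x a + dist a b + dist y b" "dist a b \<le> dist x a + dist x y + dist y b"
        by (metric)+
      then have "0 < dist a b" "dist a b < \<delta>"
        using a b r by linarith+
      then show ?thesis
        using a b by (force simp: separated_sets_def)
    qed
    moreover have "r > 0"
      using close by (simp add: r_def)
    ultimately show ?thesis
      by (auto simp: disjnt_iff)
  next
    case far
    \<comment> \<open>The slab \<open>S\<close> is closed and disjoint from the compact set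
      \<open>K\<close>, hence at positive distance from it.\<close>
    define S :: "(real ^ 'n) set" where "S = {p. \<delta> \<le> p $ i \<and> p $ i \<le> 1 - \<delta>}"
    have "closed S"
      unfolding S_def by (intro closed_Collect_conj closed_Collect_le continuous_intros)
    moreover have "compact K" "K \<inter> S = {}"
      using K far by (auto simp: hyperspace_def S_def)
    ultimately obtain r where r: "r > 0" "\<forall>x\<in>K. \<forall>y\<in>S. r \<le> dist x y"
      using separate_compact_closed by blast
    have "F \<notin> separated_sets i \<delta>" if F: "F \<in> cube.mball K r" for F
    proof
      assume "F \<in> separated_sets i \<delta>"
      then obtain q where q: "q \<in> F" "q \<in> S"
        by (auto simp: separated_sets_def S_def)
      obtain p where "p \<in> K" "dist q p < r"
        using hausdist_obtain [of F _ K r q] F K q by (auto simp: cube.commute)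
      then show False
        using r q by (force simp: dist_commute)
    qed
    then show ?thesis
      using r by (auto simp: disjnt_iff)
  qed
qed

section \<open>Strong porosity of the two families\<close>

lemma strongly_porous_face_sets:
  fixes i :: "'n::finite"
  shows "cube.strongly_porous (face_sets i)"
proof (rule cube.strongly_porous_closedin [OF closedin_face_sets hyperspace_unit_cube_perfect])
  fix K :: "(real ^ 'n) set" and e :: real
  assume Kf: "K \<in> face_sets i" and e: "e > 0"
  then have K: "K \<in> hyperspace unit_cube"
    by (simp add: face_sets_def)
  obtain p where p: "p \<in> K" "p \<in> unit_cube" "p $ i = 0 \<or> p $ i = 1"
    using Kf by (auto simp: face_sets_def hyperspace_def)
  \<comment> \<open>Since \<open>p\<close> lies on a face, staying in the cube forces the shift
    inward; \<open>s \<le> 1 / 2\<close> then puts \<open>q\<close> at distance at least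
    \<open>s\<close> from both faces.\<close>
  define s where "s = min (e / 2) (1 / 2)"
  have s: "0 < s" "s \<le> 1 / 2" "s < e"
    using e by (auto simp: s_def min_def)
  obtain t where t: "\<bar>t\<bar> = s" "p + axis i t \<in> unit_cube"
    using unit_cube_obtain_shift [OF p(2) s(1,2)] by blast
  define q where "q = p + axis i t"
  have "q $ i = p $ i + t"
    by (simp add: q_def)
  moreover have "0 \<le> q $ i" "q $ i \<le> 1"
    using t(2) by (auto simp: q_def unit_cube_def simp del: vector_add_component)
  ultimately have qi: "q $ i = p $ i + t" "0 \<le> q $ i" "q $ i \<le> 1" .
  define L where "L = insert q K"
  have L: "L \<in> hyperspace unit_cube"
    using insert_in_hyperspace K t(2) by (simp add: L_def q_def)
  have "hausdist unit_cube K L \<le> s"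
  proof (rule hausdist_le [OF K L])
    show "\<exists>b\<in>L. dist a b \<le> s" if "a \<in> K" for a
      using that s by (intro bexI [of _ a]) (auto simp: L_def)
    have "dist q p = s"
      unfolding q_def dist_commute [of _ p] dist_self_add_axis by (fact t(1))
    then show "\<exists>a\<in>K. dist b a \<le> s" if "b \<in> L" for b
      using that p s by (cases "b = q") (auto simp: L_def intro: bexI [of _ b])
  qed (use s in simp)
  moreover have "F \<notin> face_sets i" if F: "F \<in> cube.mball L s" for F
  proof -
    obtain x where x: "x \<in> F" "dist q x < s"
      using hausdist_obtain [OF L, of F s q] F by (auto simp: L_def)
    then have "x $ i \<noteq> 0" "x $ i \<noteq> 1"
      using abs_nth_diff_le_dist [of q i x] p(3) t(1) s qi by auto
    then show ?thesis
      using x by (auto simp: face_sets_def)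
  qed
  ultimately show "\<exists>L\<in>hyperspace unit_cube. \<exists>t. 0 < t \<and> t < e \<and> hausdist unit_cube K L \<le> t \<and>
      cube.mball L t \<inter> face_sets i = {}"
    using L s by blast
qed

lemma strongly_porous_separated_sets:
  fixes i :: "'n::finite"
  assumes \<delta>: "\<delta> > 0"
  shows "cube.strongly_porous (separated_sets i \<delta>)"
proof (rule cube.strongly_porous_closedin [OF closedin_separated_sets hyperspace_unit_cube_perfect])
  fix K :: "(real ^ 'n) set" and e :: real
  assume Ks: "K \<in> separated_sets i \<delta>" and e: "e > 0"
  then have K: "K \<in> hyperspace unit_cube"
    by (simp add: separated_sets_def)
  obtain p where p: "p \<in> K" "p \<in> unit_cube" "\<delta> \<le> p $ i" "p $ i \<le> 1 - \<delta>"
    using Ks by (auto simp: separated_sets_def hyperspace_def)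
  \<comment> \<open>The bound \<open>\<delta> / 4\<close> also keeps both shifted points in the
    cube, because \<open>p $ i\<close> is at least \<open>\<delta>\<close> away from 0 and
    1.\<close>
  define t where "t = min (e / 2) (\<delta> / 4)"
  have t: "0 < t" "t < e" "4 * t \<le> \<delta>"
    using e \<delta> by (auto simp: t_def min_def)
  define q where "q = p + axis i t"
  define q' where "q' = p + axis i (- t)"
  have cube: "q \<in> unit_cube" "q' \<in> unit_cube"
    unfolding q_def q'_def using p t by (auto intro!: add_axis_in_unit_cube)
  have dist: "dist q p = t" "dist q' p = t" "dist q q' = 2 * t"
    unfolding q_def q'_def dist_commute [of _ p] dist_self_add_axis dist_add_axis
    using t by auto
  define L where "L = insert q (insert q' K)"
  have L: "L \<in> hyperspace unit_cube"
    unfolding L_def by (intro insert_in_hyperspace K cube)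
  have "hausdist unit_cube K L \<le> t"
  proof (rule hausdist_le [OF K L])
    show "\<exists>b\<in>L. dist a b \<le> t" if "a \<in> K" for a
      using that t by (intro bexI [of _ a]) (auto simp: L_def)
    show "\<exists>a\<in>K. dist b a \<le> t" if "b \<in> L" for b
      using that p t dist
      by (cases "b \<in> K") (auto simp: L_def intro: bexI [of _ b] bexI [of _ p])
  qed (use t in simp)
  moreover have "F \<notin> separated_sets i \<delta>" if F: "F \<in> cube.mball L t" for F
  proof -
    obtain a where a: "a \<in> F" "dist q a < t"
      using hausdist_obtain [OF L, of F t q] F by (auto simp: L_def)
    obtain b where b: "b \<in> F" "dist q' b < t"
      using hausdist_obtain [OF L, of F t q'] F by (auto simp: L_def)
    have "dist q q' \<le> dist q a + dist a b + dist q' b" "dist a b \<le> dist q a + dist q q' + dist q' b"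
      by metric+
    \<comment> \<open>The centres \<open>q\<close> and \<open>q'\<close> are \<open>2 * t\<close>
      apart, so their open \<open>t\<close>-balls are disjoint and \<open>a\<close>,
      \<open>b\<close> differ; also \<open>dist a b < t + 2 * t + t \<le> \<delta>\<close>.\<close>
    then have "0 < dist a b" "dist a b < \<delta>"
      using a b dist t by linarith+
    then show ?thesis
      using a b by (force simp: separated_sets_def)
  qed
  ultimately show "\<exists>L\<in>hyperspace unit_cube. \<exists>t. 0 < t \<and> t < e \<and> hausdist unit_cube K L \<le> t \<and>
      cube.mball L t \<inter> separated_sets i \<delta> = {}"
    using L t by blast
qed

section \<open>Covering the finite sets by countably many members of the families\<close>

lemma finite_in_face_or_separated_sets:
  fixes F :: "(real ^ 'n) set"
  assumes F: "F \<subseteq> unit_cube" "finite F" "F \<noteq> {}"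
  shows "F \<in> face_sets i \<or> (\<exists>n. F \<in> separated_sets i (inverse (real (Suc n))))"
proof (unfold disj_imp, rule impI)
  have H: "F \<in> hyperspace unit_cube"
    using F by (simp add: hyperspace_def finite_imp_compact)
  assume "F \<notin> face_sets i"
  then obtain p where p: "p \<in> F" "p $ i \<noteq> 0" "p $ i \<noteq> 1"
    using H by (auto simp: face_sets_def)
  then have "0 < p $ i" "0 < 1 - p $ i"
    using F(1) by (auto simp: unit_cube_def order.strict_iff_order)
  moreover have ev: "\<forall>\<^sub>F n in sequentially. inverse (real (Suc n)) \<le> c" if "c > 0" for c
    using order_tendstoD(2) [OF LIMSEQ_inverse_real_of_nat that] by eventually_elim simp
  moreover have "\<forall>\<^sub>F n in sequentially. \<forall>x\<in>F. \<forall>y\<in>F. x \<noteq> y \<longrightarrow> inverse (real (Suc n)) \<le> dist x y"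
    using F(2) ev by (intro eventually_ball_finite ballI) (auto intro: eventually_mono)
  \<comment> \<open>By finiteness of \<open>F\<close>, only finitely many positive numbers have to
    be undercut, so one large \<open>n\<close> serves for all of them.\<close>
  ultimately have "\<forall>\<^sub>F n in sequentially. inverse (real (Suc n)) \<le> p $ i \<and>
      inverse (real (Suc n)) \<le> 1 - p $ i \<and>
      (\<forall>x\<in>F. \<forall>y\<in>F. x \<noteq> y \<longrightarrow> inverse (real (Suc n)) \<le> dist x y)"
    by (intro eventually_conj) auto
  then obtain n where "inverse (real (Suc n)) \<le> p $ i" "inverse (real (Suc n)) \<le> 1 - p $ i"
      "\<forall>x\<in>F. \<forall>y\<in>F. x \<noteq> y \<longrightarrow> inverse (real (Suc n)) \<le> dist x y"
    using eventually_happens by force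
  then have "F \<in> separated_sets i (inverse (real (Suc n)))"
    unfolding separated_sets_def using H p(1) by (auto intro!: bexI [of _ p])
  then show "\<exists>n. F \<in> separated_sets i (inverse (real (Suc n)))" ..
qed

theorem proposition3p3:
  shows "Metric_space.sigma_strongly_porous
           (hyperspace (unit_cube :: (real ^ 'd) set)) (hausdist unit_cube)
           {F. F \<subseteq> unit_cube \<and> finite F \<and> F \<noteq> {}}"
proof -
  fix i :: 'd
  \<comment> \<open>In dimension at least 2 the face family also contains infinite sets.
    Intersecting with the finite sets makes the union exact, and strong porosity passes to
    subsets.\<close>
  define \<A> where "\<A> = (\<lambda>C. C \<inter> {F. finite F}) `
    insert (face_sets i) (range (\<lambda>n. separated_sets i (inverse (real (Suc n)))))"
  have "countable \<A>"
    by (simp add: \<A>_def)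
  moreover have "\<forall>A\<in>\<A>. cube.strongly_porous A"
    unfolding \<A>_def
    by (auto simp del: of_nat_Suc
        intro: cube.strongly_porous_subset [OF strongly_porous_face_sets Int_lower1]
          cube.strongly_porous_subset [OF strongly_porous_separated_sets Int_lower1])
  moreover have "{F. F \<subseteq> unit_cube \<and> finite F \<and> F \<noteq> {}} = \<Union>\<A>"
  proof
    show "{F. F \<subseteq> unit_cube \<and> finite F \<and> F \<noteq> {}} \<subseteq> \<Union>\<A>"
      using finite_in_face_or_separated_sets [of _ i] by (auto simp: \<A>_def)
    show "\<Union>\<A> \<subseteq> {F. F \<subseteq> unit_cube \<and> finite F \<and> F \<noteq> {}}"
      by (auto simp: \<A>_def face_sets_def separated_sets_def hyperspace_def)
  qed
  ultimately show ?thesis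
    unfolding cube.sigma_strongly_porous_def by blast
qed

end
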